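(* Let $f:[1,\infty)\to[1,\infty)$ be an admissible function. Let $X=(X_k)_{k\in\mathbb{N}}$ be a sequence of independent Bernoulli random variables with $$\mathbb{P}[X_k=1]=1-\mathbb{P}[X_k=0]=\frac{1}{kf(k)},\qquad k\in\mathbb{N}.$$ Let $\mathcal{E}_X=\{k\in\mathbb{N}: X_k=1\}$ and let $\mathcal{N}_n=|\mathcal{E}_X\cap(2^n,2^{n+1}]|$ for $n\in\mathbb{N}$. Then almost surely $$\limsup_{n\to\infty}\mathcal{N}_n\cdot\mathcal{N}_{n+1}=0.$$ In particular, almost surely, $\mathcal{E}_X$ is a lacunary sequence.
   Context: $\mathbb{N}=\{1,2,\dots\}$, and $|A|$ denotes the cardinality of a set $A$. A function $f:[1,\infty)\to[1,\infty)$ is called admissible if $f$ is non-decreasing and, for any $\epsilon>0$, $\int_1^\infty\frac{dx}{xf(x)}=\infty$ and $\int_1^\infty\frac{dx}{xf(x)^{1+\epsilon}}<\infty$. An infinite subset $S\subset\mathbb{N}$, written as an increasing sequence $S=\{n_1<n_2<\cdots\}$, is called a lacunary sequence if $\liminf_{k\to\infty}\frac{n_{k+1}}{n_k}>1$. *)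

theory Defs
  imports "HOL-Probability.Probability"
begin

text \<open>Functions \<open>[1,\<infinity>) \<Rightarrow> [1,\<infinity>)\<close> are total functions on the reals whose values outside
  \<open>[1,\<infinity>)\<close> are irrelevant. The integrands are nonnegative, so divergence and convergence are
  read off the extended nonnegative Lebesgue integral.\<close>

definition admissible :: "(real \<Rightarrow> real) \<Rightarrow> bool" where
  "admissible f \<longleftrightarrow>
     f \<in> {1..} \<rightarrow> {1..} \<and>
     mono_on {1..} f \<and>
     (\<integral>\<^sup>+ x\<in>{1..}. ennreal (1 / (x * f x)) \<partial>lborel) = \<infinity> \<and>
     (\<forall>\<epsilon>>0. (\<integral>\<^sup>+ x\<in>{1..}. ennreal (1 / (x * f x powr (1 + \<epsilon>))) \<partial>lborel) < \<infinity>)"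

text \<open>\<open>enumerate S\<close> lists \<open>S\<close> increasingly from index 0 rather than 1, which does not affect
  the limit inferior. The limit inferior may be \<open>\<infinity>\<close>, hence the extended reals.\<close>

definition lacunary :: "nat set \<Rightarrow> bool" where
  "lacunary S \<longleftrightarrow>
     S \<subseteq> {1..} \<and> infinite S \<and>
     liminf (\<lambda>k. ereal (real (enumerate S (Suc k)) / real (enumerate S k))) > 1"

definition event_set :: "(nat \<Rightarrow> 'a \<Rightarrow> real) \<Rightarrow> 'a \<Rightarrow> nat set" where
  "event_set X \<omega> = {k \<in> {1..}. X k \<omega> = 1}"

definition block_count :: "(nat \<Rightarrow> 'a \<Rightarrow> real) \<Rightarrow> nat \<Rightarrow> 'a \<Rightarrow> nat" where
  "block_count X n \<omega> = card (event_set X \<omega> \<inter> {2 ^ n <.. 2 ^ (n + 1)})"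

end

theory Submission
  imports Defs
begin

text \<open>The proof applies both Borel--Cantelli lemmas. Write \<open>p\<^sub>k = 1/(k f(k))\<close> and let
  \<open>B\<^sub>n\<close> be the event that two distinct \<open>k\<close> in the window \<open>(2^n, 2^(n+2)]\<close> have \<open>X\<^sub>k = 1\<close>.
  By independence and a union bound (\<open>prob_two_events_le\<close>), the probability of \<open>B\<^sub>n\<close> is at most
  the square of the sum of the \<open>p\<^sub>k\<close> over the window; since the window has \<open>3 * 2^n\<close> elements and
  \<open>f\<close> is monotone, this is at most \<open>9 / f(2^n)^2\<close>. Comparing the dyadic sum with the
  integral of \<open>1/(x f(x)^2)\<close> (\<open>lower_sum_le_set_nn_integral\<close>), which is finite by
  admissibility with \<open>\<epsilon> = 1\<close>, shows that these bounds are summable. Hence almost surely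
  only finitely many \<open>B\<^sub>n\<close> occur.

  Outside \<open>B\<^sub>n\<close> the blocks \<open>n\<close> and \<open>n + 1\<close> cannot both be occupied, so the products of
  consecutive block counts vanish eventually (\<open>block_count_product_eq_0\<close>). Moreover, if \<open>a\<close> in \<open>(2^n, 2^(n+1)]\<close> is an event
  time, then the next event time exceeds \<open>2^(n+2)\<close>, which is at least \<open>2 a\<close>; so the
  ratios of consecutive event times are eventually at least 2
  (\<open>lacunary_if_sparse_windows\<close>). Using windows of two blocks
  handles pairs in the same block and pairs in adjacent blocks simultaneously.

  Finally, divergence of the integral of \<open>1/(x f(x))\<close> makes the sum of the \<open>p\<^sub>k\<close> diverge
  (\<open>set_nn_integral_le_upper_sum\<close>), and the second Borel--Cantelli lemma
  (\<open>borel_cantelli_AE2\<close>) shows that the set of event times is almost surely infinite.\<close>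

section \<open>Comparing sums with integrals of decreasing functions\<close>

lemma disjoint_family_steps:
  fixes a :: "nat \<Rightarrow> real"
  assumes "mono a"
  shows "disjoint_family (\<lambda>n. {a n..<a (Suc n)})"
proof -
  have "{a i..<a (Suc i)} \<inter> {a j..<a (Suc j)} = {}" if "i < j" for i j
    using monoD[OF assms, of "Suc i" j] that by auto
  then show ?thesis
    unfolding disjoint_family_on_def by (metis Int_commute linorder_neqE_nat)
qed

lemma nn_integral_steps:
  fixes a :: "nat \<Rightarrow> real" and c :: "nat \<Rightarrow> ennreal"
  assumes "mono a"
  shows "(\<integral>\<^sup>+ x. (\<Sum>n. c n * indicator {a n..<a (Suc n)} x) \<partial>lborel) =
    (\<Sum>n. c n * ennreal (a (Suc n) - a n))"
  using monoD[OF assms, of n "Suc n" for n]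
  by (subst nn_integral_suminf) (auto simp: nn_integral_cmult_indicator)

text \<open>No measurability of \<open>g\<close> is needed in the next two lemmas, since only the step functions
  have to be integrated termwise.\<close>

lemma lower_sum_le_set_nn_integral:
  fixes g :: "real \<Rightarrow> ennreal" and a :: "nat \<Rightarrow> real"
  assumes g: "antimono_on {a 0..} g" and a: "mono a"
  shows "(\<Sum>n. g (a (Suc n)) * ennreal (a (Suc n) - a n)) \<le> (\<integral>\<^sup>+ x\<in>{a 0..}. g x \<partial>lborel)"
proof -
  have "(\<Sum>n. g (a (Suc n)) * indicator {a n..<a (Suc n)} x) \<le> g x * indicator {a 0..} x" for x
  proof (cases "\<exists>n. x \<in> {a n..<a (Suc n)}")
    case True
    then obtain n where n: "x \<in> {a n..<a (Suc n)}" by blast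
    have "a 0 \<le> a n" using monoD[OF a] by simp
    then have "g (a (Suc n)) \<le> g x"
      using n by (intro monotone_onD[OF g, of x "a (Suc n)"]) auto
    then show ?thesis
      using suminf_cmult_indicator[OF disjoint_family_steps[OF a] n] \<open>a 0 \<le> a n\<close> n by simp
  next
    case False
    then have "g (a (Suc n)) * indicator {a n..<a (Suc n)} x = 0" for n
      by (metis indicator_simps(2) mult_zero_right)
    then have "(\<Sum>n. g (a (Suc n)) * indicator {a n..<a (Suc n)} x) = 0"
      by (simp only: suminf_zero)
    then show ?thesis by simp
  qed
  then show ?thesis
    unfolding nn_integral_steps[OF a, symmetric] by (intro nn_integral_mono)
qed

lemma set_nn_integral_le_upper_sum:
  fixes g :: "real \<Rightarrow> ennreal" and a :: "nat \<Rightarrow> real"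
  assumes g: "antimono_on {a 0..} g" and a: "mono a" and unbounded: "\<And>x. \<exists>n. x < a n"
  shows "(\<integral>\<^sup>+ x\<in>{a 0..}. g x \<partial>lborel) \<le> (\<Sum>n. g (a n) * ennreal (a (Suc n) - a n))"
proof -
  have "g x * indicator {a 0..} x \<le> (\<Sum>n. g (a n) * indicator {a n..<a (Suc n)} x)" for x
  proof (cases "a 0 \<le> x")
    case True
    define m where "m = (LEAST n. x < a n)"
    have m: "x < a m" unfolding m_def using unbounded by (rule LeastI_ex)
    then obtain n where n: "m = Suc n" using True by (cases m) auto
    have "\<not> x < a n" using not_less_Least[of n "\<lambda>n. x < a n"] n by (simp add: m_def)
    then have x: "x \<in> {a n..<a (Suc n)}" using m n by auto
    have "a 0 \<le> a n" using monoD[OF a] by simp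
    then have "g x \<le> g (a n)"
      using x by (intro monotone_onD[OF g, of "a n" x]) auto
    then show ?thesis
      using suminf_cmult_indicator[OF disjoint_family_steps[OF a] x] True by simp
  qed simp
  then show ?thesis
    unfolding nn_integral_steps[OF a, symmetric] by (intro nn_integral_mono)
qed

section \<open>Consequences of admissibility\<close>

lemma admissible_ge_1: "admissible f \<Longrightarrow> 1 \<le> x \<Longrightarrow> 1 \<le> f x"
  by (auto simp: admissible_def Pi_iff)

lemma admissible_mono: "admissible f \<Longrightarrow> 1 \<le> x \<Longrightarrow> x \<le> y \<Longrightarrow> f x \<le> f y"
  by (auto simp: admissible_def intro: mono_onD)

lemma antimono_on_inverse_admissible:
  assumes f: "admissible f" and "s \<ge> 0"
  shows "antimono_on {1..} (\<lambda>x. ennreal (1 / (x * f x powr s)))"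
proof (rule monotone_onI, rule ennreal_leI)
  fix x y :: real assume *: "x \<in> {1..}" "y \<in> {1..}" "x \<le> y"
  have "1 \<le> f x" "f x \<le> f y"
    using * admissible_ge_1[OF f, of x] admissible_mono[OF f, of x y] by auto
  then show "1 / (y * f y powr s) \<le> 1 / (x * f x powr s)"
    using * \<open>s \<ge> 0\<close> by (intro divide_left_mono mult_mono powr_mono2 mult_pos_pos) auto
qed

lemma admissible_not_summable:
  assumes f: "admissible f"
  shows "\<not> summable (\<lambda>k. 1 / (real k * f (real k)))"
proof
  assume "summable (\<lambda>k. 1 / (real k * f (real k)))"
  then have "summable (\<lambda>n. 1 / (real (Suc n) * f (real (Suc n))))"
    by (subst summable_Suc_iff)
  then have "(\<Sum>n. ennreal (1 / (real (Suc n) * f (real (Suc n))))) \<noteq> \<infinity>"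
    using order_trans[OF zero_le_one admissible_ge_1[OF f]]
    by (subst suminf_ennreal2) auto
  moreover have "(\<integral>\<^sup>+ x\<in>{1..}. ennreal (1 / (x * f x)) \<partial>lborel) \<le>
      (\<Sum>n. ennreal (1 / (real (Suc n) * f (real (Suc n)))))"
  proof -
    have anti: "antimono_on {1..} (\<lambda>x. ennreal (1 / (x * f x)))"
    proof (rule monotone_onI)
      fix x y :: real assume *: "x \<in> {1..}" "y \<in> {1..}" "x \<le> y"
      then have "1 \<le> f x" "1 \<le> f y" using admissible_ge_1[OF f] by auto
      then show "ennreal (1 / (y * f y)) \<le> ennreal (1 / (x * f x))"
        using monotone_onD[OF antimono_on_inverse_admissible[OF f, of 1] *] by simp
    qed
    have "\<exists>n. x < real (Suc n)" for x
    proof -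
      obtain n where "x < real n" using reals_Archimedean2 by blast
      then show ?thesis by (intro exI[of _ n]) simp
    qed
    then show ?thesis
      using set_nn_integral_le_upper_sum[of "\<lambda>n. real (Suc n)" "\<lambda>x. ennreal (1 / (x * f x))"] anti
      by (simp add: mono_def)
  qed
  ultimately show False
    using f by (simp add: admissible_def top_unique)
qed

lemma admissible_summable_dyadic:
  assumes f: "admissible f"
  shows "summable (\<lambda>n. 1 / (f (2 ^ n))\<^sup>2)"
proof -
  have pos: "f (2 ^ n) \<ge> 1" for n by (intro admissible_ge_1[OF f]) simp
  let ?g = "\<lambda>x. ennreal (1 / (x * f x powr 2))"
  have "(\<integral>\<^sup>+ x\<in>{1..}. ?g x \<partial>lborel) < \<infinity>"
    using f zero_less_one[where 'a = real] unfolding admissible_def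
    by (metis one_add_one)
  moreover have "(\<Sum>n. ?g (2 ^ Suc n) * ennreal (2 ^ Suc n - 2 ^ n)) \<le> (\<integral>\<^sup>+ x\<in>{1..}. ?g x \<partial>lborel)"
    using lower_sum_le_set_nn_integral[of "\<lambda>n. 2 ^ n" ?g]
      antimono_on_inverse_admissible[OF f, of 2] by (simp add: mono_def)
  \<comment> \<open>The step has length \<open>2^n\<close>, which is half of the factor \<open>x = 2^(n+1)\<close> in the denominator.\<close>
  moreover have "?g (2 ^ Suc n) * ennreal (2 ^ Suc n - 2 ^ n) = ennreal (1 / 2 * (1 / (f (2 ^ Suc n))\<^sup>2))" for n
    using pos[of "Suc n"] by (subst ennreal_mult[symmetric]) (auto simp: field_simps)
  ultimately have "(\<Sum>n. ennreal (1 / 2 * (1 / (f (2 ^ Suc n))\<^sup>2))) < \<infinity>"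
    by (simp only:)
  then have "summable (\<lambda>n. 1 / 2 * (1 / (f (2 ^ Suc n))\<^sup>2))"
    by (intro summable_suminf_not_top) auto
  then have "summable (\<lambda>n. 1 / (f (2 ^ Suc n))\<^sup>2)"
    by (subst (asm) summable_cmult_iff) auto
  then show ?thesis by (subst (asm) summable_Suc_iff)
qed

section \<open>Independent events\<close>

context prob_space
begin

lemma indep_events_compl:
  assumes "indep_events A I"
  shows "indep_events (\<lambda>i. space M - A i) I"
proof -
  have "indep_sets (\<lambda>i. sigma_sets (space M) {A i}) I"
    using assms by (intro indep_sets_sigma) (auto simp: indep_events_def_alt Int_stable_def)
  then show ?thesis
    unfolding indep_events_def_alt
    by (rule indep_sets_mono_sets) (auto intro: sigma_sets.intros)
qed

text \<open>The second Borel--Cantelli lemma, for events that are independent from index \<open>k\<close> onwards.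
  For \<open>m \<ge> k\<close>, the intersection of the complements from index \<open>m\<close> onwards has probability
  at most \<open>exp (- (\<Sum>n<N. prob (A (n + m))))\<close> for every \<open>N\<close>, hence probability zero.\<close>

lemma borel_cantelli_AE2:
  fixes A :: "nat \<Rightarrow> 'a set"
  assumes indep: "indep_events A {k..}" and not_summable: "\<not> summable (\<lambda>n. prob (A n))"
  shows "AE x in M. \<exists>\<^sub>\<infinity>n. x \<in> A n"
proof -
  have A: "A n \<in> events" if "n \<ge> k" for n
    using indep that by (auto simp: indep_events_def)
  have "AE x in M. \<exists>n\<ge>m. x \<in> A n" if "m \<ge> k" for m
  proof -
    define B where "B = (\<Inter>n\<in>{m..}. space M - A n)"
    have B: "B \<in> events"
      unfolding B_def using A \<open>m \<ge> k\<close> by (intro sets.countable_INT) auto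
    have le: "prob B \<le> exp (- (\<Sum>n<N. prob (A (n + m))))" for N
    proof (cases "N = 0")
      case False
      let ?J = "{m..<m + N}"
      have J: "?J \<noteq> {}" "finite ?J" "?J \<subseteq> {k..}" using False \<open>m \<ge> k\<close> by auto
      have "prob B \<le> prob (\<Inter>n\<in>?J. space M - A n)"
        using A J by (intro finite_measure_mono sets.finite_INT) (auto simp: B_def)
      also have "\<dots> = (\<Prod>n\<in>?J. prob (space M - A n))"
        using indep_events_compl[OF indep] J unfolding indep_events_def by blast
      also have "\<dots> = (\<Prod>n\<in>?J. 1 - prob (A n))"
        using A J by (intro prod.cong) (auto simp: prob_compl)
      also have "\<dots> \<le> (\<Prod>n\<in>?J. exp (- prob (A n)))"
        using exp_ge_add_one_self[of "- prob (A n)" for n] by (intro prod_mono) auto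
      also have "\<dots> = exp (- (\<Sum>n\<in>?J. prob (A n)))"
        by (simp add: exp_sum sum_negf[symmetric])
      also have "(\<Sum>n\<in>?J. prob (A n)) = (\<Sum>n<N. prob (A (n + m)))"
        using sum.shift_bounds_nat_ivl[of "\<lambda>n. prob (A n)" 0 m N]
        by (simp add: add.commute atLeast0LessThan)
      finally show ?thesis .
    qed simp
    have "prob B = 0"
    proof (rule ccontr)
      assume "prob B \<noteq> 0"
      then have "0 < prob B" by (simp add: zero_less_measure_iff)
      then have "(\<Sum>n<N. prob (A (n + m))) \<le> - ln (prob B)" for N
        using le[of N] ln_mono[of "prob B" "exp (- (\<Sum>n<N. prob (A (n + m))))"] by simp
      then have "summable (\<lambda>n. prob (A (n + m)))"
        by (intro summableI_nonneg_bounded) auto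
      then show False using not_summable summable_iff_shift[of "\<lambda>n. prob (A n)" m] by blast
    qed
    then have "AE x in M. x \<notin> B"
      using B by (simp add: prob_eq_0)
    then show ?thesis
      by (rule AE_mp) (auto intro!: AE_I2 simp: B_def)
  qed
  then have "AE x in M. \<forall>m. \<exists>n\<ge>max k m. x \<in> A n"
    by (subst AE_all_countable) (intro allI, simp only: max.cobounded1)
  then show ?thesis
    by (rule AE_mp) (auto intro!: AE_I2 simp: INFM_nat_le)
qed

text \<open>The event that two distinct \<open>A i\<close> with \<open>i \<in> J\<close> occur is written as a union over ordered
  pairs.\<close>

lemma sets_two_events:
  assumes "finite J" "\<And>i. i \<in> J \<Longrightarrow> A i \<in> events"
  shows "(\<Union>i\<in>J. \<Union>j\<in>J - {i}. A i \<inter> A j) \<in> events"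
  using assms by (intro sets.finite_UN sets.Int) auto

lemma prob_two_events_le:
  assumes indep: "indep_events A I" and J: "finite J" "J \<subseteq> I"
  shows "prob (\<Union>i\<in>J. \<Union>j\<in>J - {i}. A i \<inter> A j) \<le> (\<Sum>i\<in>J. prob (A i))\<^sup>2"
proof -
  have A: "A i \<in> events" if "i \<in> J" for i
    using indep J that by (auto simp: indep_events_def)
  have "prob (A i \<inter> A j) = prob (A i) * prob (A j)" if "i \<in> J" "j \<in> J - {i}" for i j
  proof -
    have "{i, j} \<subseteq> I" using J that by auto
    then have "prob (\<Inter>l\<in>{i, j}. A l) = (\<Prod>l\<in>{i, j}. prob (A l))"
      using indep unfolding indep_events_def by (metis finite.emptyI finite.insertI insert_not_empty)
    moreover have "i \<notin> {j}" using that by auto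
    ultimately show ?thesis by simp
  qed
  note pair = this
  have "prob (\<Union>i\<in>J. \<Union>j\<in>J - {i}. A i \<inter> A j) \<le> (\<Sum>i\<in>J. prob (\<Union>j\<in>J - {i}. A i \<inter> A j))"
    using A J by (intro finite_measure_subadditive_finite) auto
  also have "\<dots> \<le> (\<Sum>i\<in>J. \<Sum>j\<in>J - {i}. prob (A i \<inter> A j))"
    using A J by (intro sum_mono finite_measure_subadditive_finite) auto
  also have "\<dots> = (\<Sum>i\<in>J. \<Sum>j\<in>J - {i}. prob (A i) * prob (A j))"
    using pair by simp
  also have "\<dots> \<le> (\<Sum>i\<in>J. \<Sum>j\<in>J. prob (A i) * prob (A j))"
    using J by (intro sum_mono sum_mono2) auto
  also have "\<dots> = (\<Sum>i\<in>J. prob (A i))\<^sup>2"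
    by (simp add: power2_eq_square sum_product)
  finally show ?thesis .
qed

end

section \<open>Sets that are sparse in dyadic windows\<close>

lemma exists_dyadic_block:
  fixes m :: nat
  assumes "2 \<le> m"
  shows "\<exists>n. 2 ^ n < m \<and> m \<le> 2 ^ (n + 1)"
proof -
  define l where "l = (LEAST l. m \<le> 2 ^ l)"
  have "m \<le> 2 ^ m" by (simp add: less_imp_le)
  then have l: "m \<le> 2 ^ l" unfolding l_def by (rule LeastI)
  then obtain n where n: "l = Suc n" using assms by (cases l) auto
  have "\<not> m \<le> 2 ^ n" using not_less_Least[of n "\<lambda>l. m \<le> 2 ^ l"] n by (simp add: l_def)
  then show ?thesis using l n by (intro exI[of _ n]) auto
qed

lemma lacunary_if_sparse_windows:
  fixes S :: "nat set"
  assumes S: "S \<subseteq> {1..}" "infinite S"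
    and sparse: "\<forall>\<^sub>F n in sequentially. \<forall>i\<in>S \<inter> {2 ^ n<..2 ^ (n + 2)}.
      \<forall>j\<in>S \<inter> {2 ^ n<..2 ^ (n + 2)}. i = j"
  shows "lacunary S"
proof -
  obtain N where N: "i = j" if "n \<ge> N" "i \<in> S \<inter> {2 ^ n<..2 ^ (n + 2)}"
    "j \<in> S \<inter> {2 ^ n<..2 ^ (n + 2)}" for n i j
    using sparse unfolding eventually_sequentially by metis
  have "2 \<le> real (enumerate S (Suc k)) / real (enumerate S k)" if k: "k \<ge> 2 ^ (N + 1)" for k
  proof -
    let ?a = "enumerate S k" and ?b = "enumerate S (Suc k)"
    have ab: "?a \<in> S" "?b \<in> S" "?a < ?b"
      using S(2) by (auto intro: enumerate_in_set enumerate_step)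
    have "(2::nat) ^ (N + 1) \<le> ?a" using le_enumerate[OF S(2), of k] k by linarith
    moreover have "(2::nat) \<le> 2 ^ (N + 1)" by simp
    ultimately obtain n where n: "2 ^ n < ?a" "?a \<le> 2 ^ (n + 1)"
      using exists_dyadic_block[of ?a] by (meson order_trans)
    have "(2::nat) ^ (N + 1) \<le> 2 ^ (n + 1)" using \<open>2 ^ (N + 1) \<le> ?a\<close> n by linarith
    then have "n \<ge> N" by (simp del: power_Suc)
    \<comment> \<open>Otherwise both elements lie in the window that starts at \<open>2^n\<close>.\<close>
    have "2 ^ (n + 2) < ?b"
    proof (rule ccontr)
      assume "\<not> 2 ^ (n + 2) < ?b"
      then have "?a = ?b" using ab n by (intro N[OF \<open>n \<ge> N\<close>]) auto
      then show False using ab by simp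
    qed
    then have "2 * ?a \<le> ?b" using n by simp
    moreover have "0 < ?a" using n by linarith
    ultimately show ?thesis by (simp add: field_simps flip: of_nat_mult)
  qed
  then have "\<forall>\<^sub>F k in sequentially. 2 \<le> ereal (real (enumerate S (Suc k)) / real (enumerate S k))"
    by (auto simp: eventually_sequentially)
  then have "2 \<le> liminf (\<lambda>k. ereal (real (enumerate S (Suc k)) / real (enumerate S k)))"
    by (rule Liminf_bounded)
  then show ?thesis
    using S unfolding lacunary_def by (auto intro: less_le_trans[of 1 2])
qed

lemma block_count_product_eq_0:
  assumes "\<forall>i\<in>event_set X \<omega> \<inter> {2 ^ n<..2 ^ (n + 2)}.
      \<forall>j\<in>event_set X \<omega> \<inter> {2 ^ n<..2 ^ (n + 2)}. i = j"
  shows "block_count X n \<omega> * block_count X (n + 1) \<omega> = 0"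
proof (rule ccontr)
  assume "block_count X n \<omega> * block_count X (n + 1) \<omega> \<noteq> 0"
  then have "event_set X \<omega> \<inter> {2 ^ n<..2 ^ (n + 1)} \<noteq> {}"
    "event_set X \<omega> \<inter> {2 ^ (n + 1)<..2 ^ (n + 1 + 1)} \<noteq> {}"
    by (auto simp: block_count_def card_eq_0_iff)
  then obtain i j where ij: "i \<in> event_set X \<omega>" "2 ^ n < i" "i \<le> 2 ^ (n + 1)"
    "j \<in> event_set X \<omega>" "2 ^ (n + 1) < j" "j \<le> 2 ^ (n + 2)"
    by auto
  moreover have "(2::nat) ^ n < 2 ^ (n + 1)" "(2::nat) ^ (n + 1) < 2 ^ (n + 2)"
    by simp_all
  ultimately have "i \<in> event_set X \<omega> \<inter> {2 ^ n<..2 ^ (n + 2)}"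
    "j \<in> event_set X \<omega> \<inter> {2 ^ n<..2 ^ (n + 2)}"
    by (auto simp del: power_Suc)
  then have "i = j" using assms by blast
  then show False using ij by simp
qed

section \<open>Almost sure sparsity of the event times\<close>

theorem theorem1p1:
  fixes M :: "'a measure" and X :: "nat \<Rightarrow> 'a \<Rightarrow> real" and f :: "real \<Rightarrow> real"
  assumes "prob_space M"
    and "admissible f"
    and "prob_space.indep_vars M (\<lambda>_. borel) X {1..}"
    and "\<And>k. k \<ge> 1 \<Longrightarrow> measure M {\<omega> \<in> space M. X k \<omega> = 1} = 1 / (real k * f (real k))"
    and "\<And>k. k \<ge> 1 \<Longrightarrow> 1 - measure M {\<omega> \<in> space M. X k \<omega> = 0} = 1 / (real k * f (real k))"
  shows "(AE \<omega> in M. limsup (\<lambda>n. ereal (real (block_count X n \<omega> * block_count X (n + 1) \<omega>))) = 0)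
    \<and> (AE \<omega> in M. lacunary (event_set X \<omega>))"
proof -
  interpret prob_space M by fact
  note f = \<open>admissible f\<close>
  define A where "A k = {\<omega> \<in> space M. X k \<omega> = 1}" for k
  define J :: "nat \<Rightarrow> nat set" where "J n = {2 ^ n<..2 ^ (n + 2)}" for n
  define B where "B n = (\<Union>i\<in>J n. \<Union>j\<in>J n - {i}. A i \<inter> A j)" for n
  have indep: "indep_events A {1..}"
    unfolding A_def using assms(3) by (rule indep_eventsI_indep_vars) simp
  have prob_A: "prob (A k) = 1 / (real k * f (real k))" if "k \<ge> 1" for k
    using assms(4)[OF that] by (simp add: A_def)
  have J: "finite (J n)" "J n \<subseteq> {1..}" for n
    by (auto simp: J_def)
  have B_events: "B n \<in> events" for n
    unfolding B_def using J indep by (intro sets_two_events) (auto simp: indep_events_def subset_eq)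

  have prob_B: "prob (B n) \<le> 9 * (1 / (f (2 ^ n))\<^sup>2)" for n
  proof -
    have f1: "1 \<le> f (2 ^ n)" by (intro admissible_ge_1[OF f]) simp
    have "prob (A k) \<le> 1 / (2 ^ n * f (2 ^ n))" if "k \<in> J n" for k
    proof -
      have "2 ^ n < k" using that by (simp add: J_def)
      then have k: "2 ^ n \<le> real k" "1 \<le> k"
        by (metis less_imp_le of_nat_le_iff of_nat_numeral of_nat_power) (use \<open>2 ^ n < k\<close> in linarith)
      then have "f (2 ^ n) \<le> f (real k)" by (intro admissible_mono[OF f]) auto
      then show ?thesis
        unfolding prob_A[OF k(2)] using k f1
        by (intro divide_left_mono mult_mono mult_pos_pos) auto
    qed
    then have "(\<Sum>k\<in>J n. prob (A k)) \<le> real (card (J n)) * (1 / (2 ^ n * f (2 ^ n)))"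
      by (rule sum_bounded_above)
    \<comment> \<open>The window has \<open>2^(n+2) - 2^n = 3 * 2^n\<close> elements.\<close>
    also have "\<dots> = 3 / f (2 ^ n)"
      using f1 by (simp add: J_def field_simps)
    finally have "(\<Sum>k\<in>J n. prob (A k))\<^sup>2 \<le> (3 / f (2 ^ n))\<^sup>2"
      by (intro power_mono sum_nonneg) auto
    then show ?thesis
      using prob_two_events_le[OF indep J[of n]] by (simp add: B_def power_divide)
  qed
  have "summable (\<lambda>n. prob (B n))"
    by (rule summable_comparison_test'[OF summable_mult[OF admissible_summable_dyadic[OF f]]])
      (use prob_B in auto)
  then have "AE \<omega> in M. \<forall>\<^sub>F n in sequentially. \<omega> \<in> space M - B n"
    using B_events by (intro borel_cantelli_AE1) (auto simp: less_top[symmetric])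
  then have sparse: "AE \<omega> in M. \<forall>\<^sub>F n in sequentially. \<forall>i\<in>event_set X \<omega> \<inter> {2 ^ n<..2 ^ (n + 2)}.
      \<forall>j\<in>event_set X \<omega> \<inter> {2 ^ n<..2 ^ (n + 2)}. i = j"
  proof (rule AE_mp, intro AE_I2 impI)
    fix \<omega> assume "\<omega> \<in> space M" "\<forall>\<^sub>F n in sequentially. \<omega> \<in> space M - B n"
    from this(2) show "\<forall>\<^sub>F n in sequentially. \<forall>i\<in>event_set X \<omega> \<inter> {2 ^ n<..2 ^ (n + 2)}.
      \<forall>j\<in>event_set X \<omega> \<inter> {2 ^ n<..2 ^ (n + 2)}. i = j"
      by (rule eventually_mono) (auto simp: B_def J_def A_def event_set_def)
  qed

  \<comment> \<open>The value of \<open>prob (A 0)\<close> is unconstrained, but irrelevant for summability.\<close>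
  have "\<not> summable (\<lambda>k. prob (A k))"
  proof
    assume "summable (\<lambda>k. prob (A k))"
    moreover have "\<forall>\<^sub>F k in sequentially. prob (A k) = 1 / (real k * f (real k))"
      using prob_A by (auto simp: eventually_sequentially)
    ultimately have "summable (\<lambda>k. 1 / (real k * f (real k)))"
      by (simp add: summable_cong)
    then show False using admissible_not_summable[OF f] by simp
  qed
  then have "AE \<omega> in M. \<exists>\<^sub>\<infinity>k. \<omega> \<in> A k"
    by (rule borel_cantelli_AE2[OF indep])
  then have infinite: "AE \<omega> in M. infinite (event_set X \<omega>)"
  proof (rule AE_mp, intro AE_I2 impI)
    fix \<omega> assume "\<exists>\<^sub>\<infinity>k. \<omega> \<in> A k"
    then have "infinite ({k. \<omega> \<in> A k} - {0})" by (simp add: INFM_iff_infinite)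
    then show "infinite (event_set X \<omega>)"
      by (rule contrapos_nn) (erule finite_subset[rotated], auto simp: A_def event_set_def)
  qed

  have "AE \<omega> in M. limsup (\<lambda>n. ereal (real (block_count X n \<omega> * block_count X (n + 1) \<omega>))) = 0"
    using sparse
  proof (rule AE_mp, intro AE_I2 impI)
    fix \<omega> assume "\<forall>\<^sub>F n in sequentially. \<forall>i\<in>event_set X \<omega> \<inter> {2 ^ n<..2 ^ (n + 2)}.
      \<forall>j\<in>event_set X \<omega> \<inter> {2 ^ n<..2 ^ (n + 2)}. i = j"
    then have "\<forall>\<^sub>F n in sequentially.
        ereal (real (block_count X n \<omega> * block_count X (n + 1) \<omega>)) = 0"
      by (rule eventually_mono) (simp only: block_count_product_eq_0 of_nat_0 zero_ereal_def)
    then show "limsup (\<lambda>n. ereal (real (block_count X n \<omega> * block_count X (n + 1) \<omega>))) = 0"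
      by (intro lim_imp_Limsup tendsto_eventually) simp_all
  qed
  moreover have "AE \<omega> in M. lacunary (event_set X \<omega>)"
    using sparse infinite
    by eventually_elim (auto intro!: lacunary_if_sparse_windows simp: event_set_def)
  ultimately show ?thesis by blast
qed

end
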